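(* Let $f=(f_1,f_2,\dots)\in\ell_1$ with $\|f\|_{\ell_1}=1$ and let $W_f=\ker f\subset c$. A norm-$1$ projection of $c$ onto $W_f$ exists if and only if $|f_j|\geq\frac12$ for some $j\geq 2$. Moreover, there exists a unique norm-$1$ projection of $c$ onto $W_f$ if and only if there exists a unique index $j_0\geq 2$ such that $|f_{j_0}|\geq\frac12$.
   Context: All spaces are real. $c$ is the Banach space of convergent sequences $x=(x_1,x_2,\dots)$ with the supremum norm. For $x\in c$ put $x_0=\lim_{i\to\infty}x_i$. An element $f\in\ell_1$ acts on $c$ by $f(x)=\sum_{i=0}^{\infty}f_{i+1}x_i$ (so $f_1$ multiplies the limit $x_0$). Projections are bounded and linear. *)

theory Defs
  imports "HOL-Analysis.Analysis"
begin

text \<open>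
  The Banach space c of real convergent sequences. The underlying function is indexed
  from 0, so that \<open>Rep_cseq x n\<close> is the entry x_(n+1) of the sequence (x_1, x_2, \<dots>).
\<close>

typedef cseq = "{s :: nat \<Rightarrow> real. convergent s}"
  by (rule exI[of _ "\<lambda>_. 0"]) (simp add: convergent_const)

setup_lifting type_definition_cseq

lemma convergent_Rep_cseq: "convergent (Rep_cseq x)"
  using Rep_cseq[of x] by simp

lemma bdd_above_Rep_cseq: "bdd_above (range (\<lambda>n. \<bar>Rep_cseq x n\<bar>))"
  using convergent_imp_Bseq[OF convergent_Rep_cseq[of x]]
  by (auto simp: Bseq_def bdd_above_def)

instantiation cseq :: real_vector
begin

lift_definition zero_cseq :: cseq is "\<lambda>_. 0"
  by (rule convergent_const)

lift_definition plus_cseq :: "cseq \<Rightarrow> cseq \<Rightarrow> cseq" is "\<lambda>x y n. x n + y n"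
  by (rule convergent_add)

lift_definition minus_cseq :: "cseq \<Rightarrow> cseq \<Rightarrow> cseq" is "\<lambda>x y n. x n - y n"
  by (rule convergent_diff)

lift_definition uminus_cseq :: "cseq \<Rightarrow> cseq" is "\<lambda>x n. - x n"
  by (simp add: convergent_minus_iff[symmetric])

lift_definition scaleR_cseq :: "real \<Rightarrow> cseq \<Rightarrow> cseq" is "\<lambda>r x n. r * x n"
  by (auto intro: convergent_mult convergent_const)

instance
proof
  fix x y z :: cseq and a b :: real
  show "x + y + z = x + (y + z)" by transfer (simp add: add.assoc)
  show "x + y = y + x" by transfer (simp add: add.commute)
  show "0 + x = x" by transfer simp
  show "- x + x = 0" by transfer simp
  show "x - y = x + - y" by transfer simp
  show "a *\<^sub>R (x + y) = a *\<^sub>R x + a *\<^sub>R y" by transfer (simp add: distrib_left)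
  show "(a + b) *\<^sub>R x = a *\<^sub>R x + b *\<^sub>R x" by transfer (simp add: distrib_right)
  show "a *\<^sub>R b *\<^sub>R x = (a * b) *\<^sub>R x" by transfer (simp add: mult.assoc)
  show "1 *\<^sub>R x = x" by transfer simp
qed

end

instantiation cseq :: real_normed_vector
begin

definition norm_cseq :: "cseq \<Rightarrow> real"
  where "norm_cseq x = (SUP n. \<bar>Rep_cseq x n\<bar>)"

definition sgn_cseq :: "cseq \<Rightarrow> cseq"
  where "sgn_cseq x = x /\<^sub>R norm x"

definition dist_cseq :: "cseq \<Rightarrow> cseq \<Rightarrow> real"
  where "dist_cseq x y = norm (x - y)"

definition uniformity_cseq :: "(cseq \<times> cseq) filter"
  where "uniformity_cseq = (INF e\<in>{0<..}. principal {(x, y). dist x y < e})"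

definition open_cseq :: "cseq set \<Rightarrow> bool"
  where "open_cseq U = (\<forall>x\<in>U. eventually (\<lambda>(x', y). x' = x \<longrightarrow> y \<in> U) uniformity)"

instance
proof
  fix x y :: cseq and a :: real
  show "dist x y = norm (x - y)" by (rule dist_cseq_def)
  show "sgn x = x /\<^sub>R norm x" by (rule sgn_cseq_def)
  show "uniformity = (INF e\<in>{0<..}. principal {(x, y :: cseq). dist x y < e})"
    by (rule uniformity_cseq_def)
  show "open U = (\<forall>x\<in>U. eventually (\<lambda>(x', y). x' = x \<longrightarrow> y \<in> U) uniformity)"
    for U :: "cseq set" by (rule open_cseq_def)
  have le: "\<bar>Rep_cseq w n\<bar> \<le> norm w" for w n
    unfolding norm_cseq_def by (rule cSUP_upper[OF UNIV_I bdd_above_Rep_cseq])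
  show "norm x = 0 \<longleftrightarrow> x = 0"
  proof
    assume "norm x = 0"
    then have "Rep_cseq x n = 0" for n using le[of x n] by simp
    then show "x = 0" by (auto simp: Rep_cseq_inject[symmetric] zero_cseq.rep_eq)
  qed (simp add: norm_cseq_def zero_cseq.rep_eq)
  show "norm (x + y) \<le> norm x + norm y"
    unfolding norm_cseq_def[of "x + y"]
  proof (rule cSUP_least)
    fix n show "\<bar>Rep_cseq (x + y) n\<bar> \<le> norm x + norm y"
      using le[of x n] le[of y n] by (simp add: plus_cseq.rep_eq)
  qed simp
  have sc: "norm (a *\<^sub>R x) \<le> \<bar>a\<bar> * norm x" for a and x :: cseq
    unfolding norm_cseq_def[of "a *\<^sub>R x"]
  proof (rule cSUP_least)
    fix n show "\<bar>Rep_cseq (a *\<^sub>R x) n\<bar> \<le> \<bar>a\<bar> * norm x"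
      using le[of x n] by (simp add: scaleR_cseq.rep_eq abs_mult mult_left_mono)
  qed simp
  show "norm (a *\<^sub>R x) = \<bar>a\<bar> * norm x"
  proof (cases "a = 0")
    case True
    have "0 \<le> norm (a *\<^sub>R x)" using le[of "a *\<^sub>R x" 0] by linarith
    with sc[of a x] True show ?thesis by simp
  next
    case False
    have "inverse a *\<^sub>R a *\<^sub>R x = x" using False by transfer simp
    then have "norm x \<le> \<bar>inverse a\<bar> * norm (a *\<^sub>R x)" using sc[of "inverse a" "a *\<^sub>R x"] by simp
    then have "\<bar>a\<bar> * norm x \<le> norm (a *\<^sub>R x)" using False by (simp add: field_simps)
    with sc[of a x] show ?thesis by simp
  qed
qed

end

lemma abs_Rep_cseq_le_norm: "\<bar>Rep_cseq x n\<bar> \<le> norm x"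
  unfolding norm_cseq_def by (rule cSUP_upper[OF UNIV_I bdd_above_Rep_cseq])

instance cseq :: banach
proof
  fix X :: "nat \<Rightarrow> cseq"
  assume "Cauchy X"
  have cau: "\<exists>M. \<forall>m\<ge>M. \<forall>n\<ge>M. \<forall>k. \<bar>Rep_cseq (X m) k - Rep_cseq (X n) k\<bar> < e" if "e > 0" for e
  proof -
    obtain M where "\<forall>m\<ge>M. \<forall>n\<ge>M. norm (X m - X n) < e"
      using CauchyD[OF \<open>Cauchy X\<close> \<open>e > 0\<close>] by auto
    then show ?thesis
      using abs_Rep_cseq_le_norm[of "X _ - X _"] by (metis minus_cseq.rep_eq le_less_trans)
  qed
  then have "uniformly_Cauchy_on UNIV (\<lambda>n. Rep_cseq (X n))"
    by (simp add: uniformly_Cauchy_on_def dist_real_def) blast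
  then obtain l where l: "uniform_limit UNIV (\<lambda>n. Rep_cseq (X n)) l sequentially"
    by (meson Cauchy_uniformly_convergent uniformly_convergent_on_def)
  have "Cauchy l"
  proof (rule CauchyI)
    fix e :: real assume "e > 0"
    then have "\<forall>\<^sub>F n in sequentially. \<forall>k\<in>UNIV. dist (Rep_cseq (X n) k) (l k) < e/3"
      using l by (intro uniform_limitD) auto
    then obtain n where n: "\<And>k. \<bar>Rep_cseq (X n) k - l k\<bar> < e/3"
      by (auto simp: eventually_sequentially dist_real_def)
    have "Cauchy (Rep_cseq (X n))" by (rule convergent_Cauchy[OF convergent_Rep_cseq])
    then obtain M where M: "\<forall>i\<ge>M. \<forall>j\<ge>M. norm (Rep_cseq (X n) i - Rep_cseq (X n) j) < e/3"
      using CauchyD[of "Rep_cseq (X n)" "e/3"] \<open>e > 0\<close> by auto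
    have "norm (l i - l j) < e" if "i \<ge> M" "j \<ge> M" for i j
      using n[of i] n[of j] M[rule_format, OF that] by (simp add: abs_if split: if_splits)
    then show "\<exists>M. \<forall>i\<ge>M. \<forall>j\<ge>M. norm (l i - l j) < e" by blast
  qed
  then have "convergent l" by (rule Cauchy_convergent)
  then have rep: "Rep_cseq (Abs_cseq l) = l" by (simp add: Abs_cseq_inverse)
  have "X \<longlonglongrightarrow> Abs_cseq l"
  proof (rule LIMSEQ_I)
    fix e :: real assume "e > 0"
    then have "\<forall>\<^sub>F n in sequentially. \<forall>k\<in>UNIV. dist (Rep_cseq (X n) k) (l k) < e/2"
      using l by (intro uniform_limitD) auto
    then obtain M where M: "\<And>n k. n \<ge> M \<Longrightarrow> \<bar>Rep_cseq (X n) k - l k\<bar> < e/2"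
      by (auto simp: eventually_sequentially dist_real_def)
    have "norm (X n - Abs_cseq l) < e" if "n \<ge> M" for n
    proof -
      have "norm (X n - Abs_cseq l) \<le> e/2"
        unfolding norm_cseq_def
        by (rule cSUP_least) (use M[OF that] in \<open>auto simp: minus_cseq.rep_eq rep intro: less_imp_le\<close>)
      then show ?thesis using \<open>e > 0\<close> by simp
    qed
    then show "\<exists>M. \<forall>n\<ge>M. norm (X n - Abs_cseq l) < e" by blast
  qed
  then show "convergent X" by (rule convergentI)
qed

definition coord :: "cseq \<Rightarrow> nat \<Rightarrow> real"
  where "coord x i = (case i of 0 \<Rightarrow> lim (Rep_cseq x) | Suc n \<Rightarrow> Rep_cseq x n)"

text \<open>
  Elements f = (f_1, f_2, \<dots>) of the real space \<open>\<ell>\<^sub>1\<close> are functions on the naturals whose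
  value at 0 is irrelevant; nothing below depends on it.
\<close>

definition l1 :: "(nat \<Rightarrow> real) set"
  where "l1 = {f. summable (\<lambda>i. \<bar>f (Suc i)\<bar>)}"

definition l1_norm :: "(nat \<Rightarrow> real) \<Rightarrow> real"
  where "l1_norm f = (\<Sum>i. \<bar>f (Suc i)\<bar>)"

definition l1_action :: "(nat \<Rightarrow> real) \<Rightarrow> cseq \<Rightarrow> real"
  where "l1_action f x = (\<Sum>i. f (i + 1) * coord x i)"

definition W :: "(nat \<Rightarrow> real) \<Rightarrow> cseq set"
  where "W f = {x. l1_action f x = 0}"

definition projection_onto :: "('a::real_normed_vector \<Rightarrow> 'a) \<Rightarrow> 'a set \<Rightarrow> bool"
  where "projection_onto P V \<longleftrightarrow> bounded_linear P \<and> P \<circ> P = P \<and> range P = V"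

end

(* A projection onto the hyperplane ker f has the form P x = x - f(x) z with f(z) = 1.
   If the coefficient g of f at the n-th entry has |g| < 1/2, then for either sign s there is
   a vector y in the unit ball with y_n = s and f(y) > 0: copy the signs of f everywhere else.
   Taking s opposite to the sign of z_n makes the n-th entry of P y larger than 1 in modulus
   unless z_n = 0. So z is supported where |f_j| >= 1/2, j >= 2; conversely each such j
   yields the norm-1 projection with z = e_j / f_j. *)
theory Submission
  imports Defs
begin

section \<open>Coordinates on the space of convergent sequences, and test vectors\<close>

lemma cseq_eqI: "(\<And>n. Rep_cseq x n = Rep_cseq y n) \<Longrightarrow> x = y"
  by (metis Rep_cseq_inject ext)

lemma norm_cseq_le: "(\<And>n. \<bar>Rep_cseq x n\<bar> \<le> B) \<Longrightarrow> norm x \<le> B"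
  unfolding norm_cseq_def by (rule cSUP_least) auto

lemma coord_Suc [simp]: "coord x (Suc n) = Rep_cseq x n"
  by (simp add: coord_def)

lemma tendsto_coord_0: "Rep_cseq x \<longlonglongrightarrow> coord x 0"
  using convergent_Rep_cseq[of x] by (simp add: coord_def convergent_LIMSEQ_iff)

lemma abs_coord_le_norm: "\<bar>coord x i\<bar> \<le> norm x"
proof (cases i)
  case 0
  have "(\<lambda>n. \<bar>Rep_cseq x n\<bar>) \<longlonglongrightarrow> \<bar>coord x 0\<bar>"
    by (intro tendsto_rabs tendsto_coord_0)
  then show ?thesis
    unfolding 0 by (rule LIMSEQ_le_const2) (use abs_Rep_cseq_le_norm in blast)
qed (simp add: abs_Rep_cseq_le_norm)

lemma coord_add: "coord (x + y) i = coord x i + coord y i"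
proof (cases i)
  case 0
  have "Rep_cseq (x + y) \<longlonglongrightarrow> coord x 0 + coord y 0"
    unfolding plus_cseq.rep_eq by (intro tendsto_add tendsto_coord_0)
  then show ?thesis
    using 0 LIMSEQ_unique tendsto_coord_0 by blast
qed (simp add: plus_cseq.rep_eq)

lemma coord_scaleR: "coord (r *\<^sub>R x) i = r * coord x i"
proof (cases i)
  case 0
  have "Rep_cseq (r *\<^sub>R x) \<longlonglongrightarrow> r * coord x 0"
    unfolding scaleR_cseq.rep_eq by (intro tendsto_mult tendsto_const tendsto_coord_0)
  then show ?thesis
    using 0 LIMSEQ_unique tendsto_coord_0 by blast
qed (simp add: scaleR_cseq.rep_eq)

text \<open>The full sign pattern of a functional need not converge, so test vectors copy it only
  before position \<open>N\<close>. The constant tail makes \<open>c\<close> the limit, which can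
  thus be chosen independently of the entries before \<open>N\<close>.\<close>

lift_definition eventually_const :: "(nat \<Rightarrow> real) \<Rightarrow> nat \<Rightarrow> real \<Rightarrow> cseq"
  is "\<lambda>h N c k. if k < N then h k else c"
proof -
  fix h :: "nat \<Rightarrow> real" and N c
  have "(\<lambda>k. if k < N then h k else c) \<longlonglongrightarrow> c"
    by (rule tendsto_eventually) (auto simp: eventually_sequentially intro!: exI[of _ N])
  then show "convergent (\<lambda>k. if k < N then h k else c)"
    by (rule convergentI)
qed

lemma coord_0_eventually_const [simp]: "coord (eventually_const h N c) 0 = c"
proof -
  have "Rep_cseq (eventually_const h N c) \<longlonglongrightarrow> c"
    unfolding eventually_const.rep_eq
    by (rule tendsto_eventually) (auto simp: eventually_sequentially intro!: exI[of _ N])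
  then show ?thesis
    using LIMSEQ_unique tendsto_coord_0 by blast
qed

definition unit_cseq :: "nat \<Rightarrow> cseq"
  where "unit_cseq n = eventually_const (\<lambda>k. if k = n then 1 else 0) (Suc n) 0"

lemma Rep_unit_cseq [simp]: "Rep_cseq (unit_cseq n) k = (if k = n then 1 else 0)"
  by (simp add: unit_cseq_def eventually_const.rep_eq)

lemma coord_unit_cseq: "coord (unit_cseq n) i = (if i = Suc n then 1 else 0)"
  by (cases i) (simp_all, simp add: unit_cseq_def)

section \<open>The functional given by an element of the sequence space \<open>l1\<close>\<close>

context
  fixes f :: "nat \<Rightarrow> real"
  assumes f: "f \<in> l1"
begin

lemma sums_l1_norm: "(\<lambda>i. \<bar>f (Suc i)\<bar>) sums l1_norm f"
  using f by (simp add: l1_def l1_norm_def summable_sums)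

lemma sums_l1_action: "(\<lambda>i. f (Suc i) * coord x i) sums l1_action f x"
proof -
  have "summable (\<lambda>i. \<bar>f (Suc i)\<bar> * norm x)"
    using sums_l1_norm by (intro summable_mult2) (rule sums_summable)
  then have "summable (\<lambda>i. f (Suc i) * coord x i)"
    by (rule summable_comparison_test'[where N = 0])
      (simp add: abs_mult abs_coord_le_norm mult_left_mono)
  then show ?thesis
    by (simp add: l1_action_def summable_sums)
qed

lemma l1_action_add: "l1_action f (x + y) = l1_action f x + l1_action f y"
  using sums_add[OF sums_l1_action[of x] sums_l1_action[of y]] sums_l1_action[of "x + y"]
  by (simp add: coord_add distrib_left sums_unique2)

lemma l1_action_scaleR: "l1_action f (r *\<^sub>R x) = r * l1_action f x"
  using sums_mult[OF sums_l1_action[of x], of r] sums_l1_action[of "r *\<^sub>R x"]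
  by (simp add: coord_scaleR mult.left_commute sums_unique2)

lemma l1_action_diff: "l1_action f (x - y) = l1_action f x - l1_action f y"
  using l1_action_add[of "x - y" y] by simp

lemma l1_action_unit_cseq: "l1_action f (unit_cseq n) = f (Suc (Suc n))"
proof -
  have "(\<lambda>i. f (Suc i) * coord (unit_cseq n) i) sums f (Suc (Suc n))"
    using sums_single[of "Suc n" "\<lambda>i. f (Suc i)"]
    by (simp add: coord_unit_cseq if_distrib[of "(*) _"] cong: if_cong)
  then show ?thesis
    using sums_l1_action sums_unique2 by blast
qed

text \<open>Once the term of entry \<open>n\<close> is deleted, the remaining coefficients have
  total modulus \<open>l1_norm f - \<bar>f (Suc (Suc n))\<bar>\<close>, and every coordinate, the
  limit included, is at most \<open>norm x\<close> in modulus.\<close>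

lemma abs_l1_action_minus_term_le:
  "\<bar>l1_action f x - f (Suc (Suc n)) * Rep_cseq x n\<bar> \<le> (l1_norm f - \<bar>f (Suc (Suc n))\<bar>) * norm x"
proof -
  let ?a = "\<lambda>i. f (Suc i) * coord x i" and ?b = "\<lambda>i. \<bar>f (Suc i)\<bar>"
  \<comment> \<open>Entry \<open>n\<close> is coordinate \<open>Suc n\<close>, since coordinate 0 is
    the limit; subtracting a one-term series deletes it.\<close>
  have a: "(\<lambda>i. ?a i - (if i = Suc n then ?a i else 0))
      sums (l1_action f x - f (Suc (Suc n)) * Rep_cseq x n)"
    using sums_diff[OF sums_l1_action sums_single[of "Suc n" ?a]] by simp
  have b: "(\<lambda>i. (?b i - (if i = Suc n then ?b i else 0)) * norm x)
      sums ((l1_norm f - \<bar>f (Suc (Suc n))\<bar>) * norm x)"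
    using sums_mult2[OF sums_diff[OF sums_l1_norm sums_single[of "Suc n" ?b]], of "norm x"] by simp
  have "norm (suminf (\<lambda>i. ?a i - (if i = Suc n then ?a i else 0)))
      \<le> suminf (\<lambda>i. (?b i - (if i = Suc n then ?b i else 0)) * norm x)"
    by (rule norm_suminf_le[OF _ sums_summable[OF b]])
      (simp add: abs_mult abs_coord_le_norm mult_left_mono)
  then show ?thesis
    using sums_unique[OF a] sums_unique[OF b] by simp
qed

text \<open>Add the term of the first entry, with coefficient \<open>f 2\<close>, back to the
  preceding bound.\<close>

lemma abs_l1_action_le: "\<bar>l1_action f x\<bar> \<le> l1_norm f * norm x"
proof -
  have "\<bar>f 2 * Rep_cseq x 0\<bar> \<le> \<bar>f 2\<bar> * norm x"
    by (simp add: abs_mult abs_Rep_cseq_le_norm mult_left_mono)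
  then show ?thesis
    using abs_l1_action_minus_term_le[of x 0] by (simp add: left_diff_distrib numeral_2_eq_2)
qed

lemma bounded_linear_l1_action: "bounded_linear (l1_action f)"
  by (rule bounded_linear_intro[where K = "l1_norm f"])
    (use abs_l1_action_le in \<open>simp_all add: l1_action_add l1_action_scaleR mult.commute\<close>)

section \<open>Constraints on projections of norm at most 1\<close>

text \<open>If \<open>y\<close> matches the signs of \<open>f\<close> except at entry
  \<open>n\<close> and far out, then \<open>l1_action f y\<close> falls short of
  \<open>l1_norm f\<close> by at most twice the modulus of the coefficients at the unmatched places.
  A late enough cutoff keeps this below \<open>l1_norm f\<close>.\<close>

lemma exists_positive_with_prescribed_sign:
  assumes small: "2 * \<bar>f (Suc (Suc n))\<bar> < l1_norm f" and s: "\<bar>s\<bar> = 1"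
  obtains y where "norm y \<le> 1" "Rep_cseq y n = s" "l1_action f y > 0"
proof -
  let ?h = "\<lambda>i. \<bar>f (Suc i)\<bar>"
  \<comment> \<open>The slack in \<open>small\<close>. A tail of total modulus below
    \<open>e / 2\<close> costs less than \<open>e\<close>, even with every sign wrong.\<close>
  define e where "e = l1_norm f - 2 * \<bar>f (Suc (Suc n))\<bar>"
  have "(\<lambda>M. \<Sum>i<M. ?h i) \<longlonglongrightarrow> l1_norm f"
    using sums_l1_norm by (simp add: sums_def)
  moreover have "l1_norm f - e / 2 < l1_norm f"
    using small by (simp add: e_def)
  ultimately have "\<forall>\<^sub>F M in sequentially. l1_norm f - e / 2 < (\<Sum>i<M. ?h i)"
    by (rule order_tendstoD)
  then obtain M where M: "\<And>m. m \<ge> M \<Longrightarrow> l1_norm f - e / 2 < (\<Sum>i<m. ?h i)"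
    by (auto simp: eventually_sequentially)
  \<comment> \<open>The cutoff lies beyond \<open>n\<close>, so the prescribed entry precedes the
    constant tail.\<close>
  define N where "N = max M (Suc n)"
  define y where "y = eventually_const
    (\<lambda>k. if k = n then s else sgn (f (Suc (Suc k)))) N (sgn (f (Suc 0)))"
  have Rep_y: "Rep_cseq y k =
      (if k = n then s else if k < N then sgn (f (Suc (Suc k))) else sgn (f (Suc 0)))" for k
    by (simp add: y_def eventually_const.rep_eq N_def)
  have y_le: "norm y \<le> 1"
    by (rule norm_cseq_le) (use s in \<open>simp add: Rep_y abs_sgn_eq\<close>)
  have lhs: "(\<lambda>i. ?h i - f (Suc i) * coord y i) sums (l1_norm f - l1_action f y)"
    by (rule sums_diff[OF sums_l1_norm sums_l1_action])
  have rhs: "(\<lambda>i. (if i = Suc n then 2 * ?h i else 0)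
      + 2 * (?h i - (if i \<in> {..<Suc N} then ?h i else 0)))
    sums (2 * ?h (Suc n) + 2 * (l1_norm f - (\<Sum>i<Suc N. ?h i)))"
    by (intro sums_add sums_single sums_mult sums_diff sums_l1_norm sums_If_finite_set) simp
  \<comment> \<open>A matched coordinate loses nothing and any other loses at most
    \<open>2 * ?h i\<close>. The range \<open>{..<Suc N}\<close> covers the limit and the first
    \<open>N\<close> entries; the limit is matched because the tail value is
    \<open>sgn (f (Suc 0))\<close>.\<close>
  have le: "?h i - f (Suc i) * coord y i \<le> (if i = Suc n then 2 * ?h i else 0)
      + 2 * (?h i - (if i \<in> {..<Suc N} then ?h i else 0))" for i
  proof -
    have "\<bar>f (Suc i) * coord y i\<bar> \<le> ?h i * 1"
      unfolding abs_mult using abs_coord_le_norm[of y i] y_le by (intro mult_left_mono) auto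
    then have general: "?h i - f (Suc i) * coord y i \<le> 2 * ?h i"
      by linarith
    have "f (Suc i) * coord y i = ?h i" if "i \<noteq> Suc n" "i < Suc N"
      using that by (cases i) (simp_all add: Rep_y, simp_all add: y_def abs_sgn)
    then show ?thesis
      using general by auto
  qed
  have "l1_norm f - l1_action f y
      \<le> 2 * ?h (Suc n) + 2 * (l1_norm f - (\<Sum>i<Suc N. ?h i))"
    by (rule sums_le[OF le lhs rhs])
  moreover have "l1_norm f - e / 2 < (\<Sum>i<Suc N. ?h i)"
    by (rule M) (simp add: N_def)
  ultimately have "l1_action f y > 0"
    unfolding e_def by argo
  then show thesis
    using that[OF y_le] by (simp add: Rep_y)
qed

text \<open>If \<open>v\<close> has action 1, then \<open>x - l1_action f x *\<^sub>R v\<close> lies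
  in the kernel and is fixed by \<open>P\<close>. Solving for \<open>P x\<close> gives
  \<open>z = v - P v\<close>. The vector \<open>w\<close> witnesses that the functional is
  nonzero.\<close>

lemma projection_onto_W_form:
  assumes P: "projection_onto P (W f)" and w: "l1_action f w \<noteq> 0"
  obtains z where "l1_action f z = 1" "\<And>x. P x = x - l1_action f x *\<^sub>R z"
proof -
  interpret P: bounded_linear P
    using P by (simp add: projection_onto_def)
  have idem: "P x = x" if "l1_action f x = 0" for x
  proof -
    have "x \<in> range P"
      using P that by (simp add: projection_onto_def W_def)
    then obtain u where "x = P u"
      by blast
    then show ?thesis
      using P by (simp add: projection_onto_def fun_eq_iff)
  qed
  have ker: "l1_action f (P x) = 0" for x
    using P by (auto simp: projection_onto_def W_def)
  define v where "v = w /\<^sub>R l1_action f w"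
  have v: "l1_action f v = 1"
    using w by (simp add: v_def l1_action_scaleR)
  show thesis
  proof
    show "l1_action f (v - P v) = 1"
      by (simp add: l1_action_diff v ker)
    fix x
    have "P (x - l1_action f x *\<^sub>R v) = x - l1_action f x *\<^sub>R v"
      by (rule idem) (simp add: l1_action_diff l1_action_scaleR v)
    then show "P x = x - l1_action f x *\<^sub>R (v - P v)"
      by (simp add: P.diff P.scaleR algebra_simps)
  qed
qed

lemma projection_vector_vanishes:
  assumes P: "bounded_linear P" "onorm P \<le> 1" "\<And>x. P x = x - l1_action f x *\<^sub>R z"
    and small: "2 * \<bar>f (Suc (Suc n))\<bar> < l1_norm f"
  shows "Rep_cseq z n = 0"
proof (rule ccontr)
  assume z: "Rep_cseq z n \<noteq> 0"
  then have "\<bar>- sgn (Rep_cseq z n)\<bar> = 1"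
    by (simp add: abs_sgn_eq)
  then obtain y where y: "norm y \<le> 1" "Rep_cseq y n = - sgn (Rep_cseq z n)" "l1_action f y > 0"
    by (rule exists_positive_with_prescribed_sign[OF small])
  have "norm (P y) \<le> onorm P * norm y"
    by (rule onorm[OF P(1)])
  also have "\<dots> \<le> 1"
    using P(2) y(1) by (simp add: mult_le_one)
  finally have "\<bar>Rep_cseq (P y) n\<bar> \<le> 1"
    using abs_Rep_cseq_le_norm order_trans by blast
  \<comment> \<open>Both terms have the sign opposite to \<open>z\<close> at \<open>n\<close>, so
    their moduli add up to more than 1.\<close>
  moreover have "Rep_cseq (P y) n = - sgn (Rep_cseq z n) - l1_action f y * Rep_cseq z n"
    by (simp add: P(3) y(2) minus_cseq.rep_eq scaleR_cseq.rep_eq)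
  moreover have "l1_action f y * \<bar>Rep_cseq z n\<bar> > 0"
    using y z by simp
  ultimately show False
    using z by (auto simp: sgn_if abs_if split: if_splits)
qed

end

section \<open>Projections that change a single entry\<close>

text \<open>For a nonzero coefficient this is the projection onto the kernel along
  \<open>unit_cseq n\<close>; the limit is left unchanged.\<close>

definition kill_coord :: "(nat \<Rightarrow> real) \<Rightarrow> nat \<Rightarrow> cseq \<Rightarrow> cseq"
  where "kill_coord f n x = x - (l1_action f x / f (Suc (Suc n))) *\<^sub>R unit_cseq n"

lemma Rep_kill_coord:
  "Rep_cseq (kill_coord f n x) k =
    (if k = n then Rep_cseq x k - l1_action f x / f (Suc (Suc n)) else Rep_cseq x k)"
  by (simp add: kill_coord_def minus_cseq.rep_eq scaleR_cseq.rep_eq)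

lemma projection_onto_kill_coord:
  assumes f: "f \<in> l1" and nz: "f (Suc (Suc n)) \<noteq> 0"
  shows "projection_onto (kill_coord f n) (W f)"
proof -
  interpret bounded_linear "l1_action f"
    by (rule bounded_linear_l1_action[OF f])
  have "bounded_linear (\<lambda>x. x - (l1_action f x / f (Suc (Suc n))) *\<^sub>R unit_cseq n)"
    unfolding divide_inverse by (intro bounded_linear_sub bounded_linear_ident
        bounded_linear_scaleR_const bounded_linear_mult_const bounded_linear_l1_action f)
  then have bl: "bounded_linear (kill_coord f n)"
    by (simp add: kill_coord_def[abs_def])
  have ker: "kill_coord f n x \<in> W f" for x
    using nz by (simp add: W_def kill_coord_def diff scaleR l1_action_unit_cseq[OF f])
  have fixed: "kill_coord f n x = x" if "x \<in> W f" for x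
    using that by (simp add: W_def kill_coord_def)
  have "range (kill_coord f n) = W f"
  proof
    show "W f \<subseteq> range (kill_coord f n)"
      using fixed by (metis rangeI subsetI)
  qed (use ker in blast)
  then show ?thesis
    using bl ker fixed by (auto simp: projection_onto_def)
qed

text \<open>The new entry \<open>n\<close> is minus the sum of the other terms of the action,
  divided by the coefficient at \<open>n\<close>. By \<open>large\<close>, the other coefficients
  have total modulus at most that of the divisor.\<close>

lemma onorm_kill_coord:
  assumes f: "f \<in> l1" and large: "2 * \<bar>f (Suc (Suc n))\<bar> \<ge> l1_norm f" and nz: "f (Suc (Suc n)) \<noteq> 0"
  shows "onorm (kill_coord f n) = 1"
proof (rule antisym)
  let ?g = "f (Suc (Suc n))" and ?P = "kill_coord f n"
  have P: "projection_onto ?P (W f)"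
    by (rule projection_onto_kill_coord[OF f nz])
  have "norm (?P x) \<le> norm x" for x
  proof (rule norm_cseq_le)
    fix k
    have "\<bar>Rep_cseq x n - l1_action f x / ?g\<bar> = \<bar>l1_action f x - ?g * Rep_cseq x n\<bar> / \<bar>?g\<bar>"
      using nz by (simp flip: abs_divide add: diff_divide_distrib abs_minus_commute)
    also have "\<dots> \<le> (l1_norm f - \<bar>?g\<bar>) * norm x / \<bar>?g\<bar>"
      by (intro divide_right_mono abs_l1_action_minus_term_le f) simp
    also have "\<dots> \<le> \<bar>?g\<bar> * norm x / \<bar>?g\<bar>"
      using large by (intro divide_right_mono mult_right_mono) auto
    also have "\<dots> = norm x"
      using nz by simp
    finally show "\<bar>Rep_cseq (?P x) k\<bar> \<le> norm x"
      by (simp add: Rep_kill_coord abs_Rep_cseq_le_norm)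
  qed
  then show "onorm ?P \<le> 1"
    using onorm_bound[of 1 ?P] by simp
  \<comment> \<open>A nonzero fixed vector gives the lower bound: changing entry \<open>n\<close>
    cannot affect the 1 at \<open>Suc n\<close>, and idempotence makes the image fixed.\<close>
  define x where "x = ?P (unit_cseq (Suc n))"
  have "Rep_cseq x (Suc n) = 1"
    by (simp add: x_def Rep_kill_coord)
  then have "norm x > 0"
    using abs_Rep_cseq_le_norm[of x "Suc n"] by linarith
  moreover have "?P x = x"
    using P by (auto simp: x_def projection_onto_def fun_eq_iff)
  ultimately show "1 \<le> onorm ?P"
    using onorm[of ?P x] P by (simp add: projection_onto_def)
qed

text \<open>The vector \<open>unit_cseq m\<close> separates the two maps: one annihilates its entry
  \<open>m\<close>, the other would keep it.\<close>

lemma kill_coord_eq_imp_eq: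
  assumes f: "f \<in> l1" and nz: "f (Suc (Suc m)) \<noteq> 0" and eq: "kill_coord f m = kill_coord f n"
  shows "m = n"
proof (rule ccontr)
  assume "m \<noteq> n"
  then have "Rep_cseq (kill_coord f n (unit_cseq m)) m = 1"
    by (simp add: Rep_kill_coord)
  moreover have "Rep_cseq (kill_coord f m (unit_cseq m)) m = 0"
    using nz by (simp add: Rep_kill_coord l1_action_unit_cseq[OF f])
  ultimately show False
    using eq by simp
qed

section \<open>Existence and uniqueness in terms of large coefficients\<close>

theorem proposition2p2:
  fixes f :: "nat \<Rightarrow> real"
  assumes "f \<in> l1" and "l1_norm f = 1"
  shows "((\<exists>P. projection_onto P (W f) \<and> onorm P = 1) \<longleftrightarrow> (\<exists>j\<ge>2. \<bar>f j\<bar> \<ge> 1/2)) \<and>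
    ((\<exists>!P. projection_onto P (W f) \<and> onorm P = 1) \<longleftrightarrow> (\<exists>!j. j \<ge> 2 \<and> \<bar>f j\<bar> \<ge> 1/2))"
proof -
  let ?Q = "\<lambda>P. projection_onto P (W f) \<and> onorm P = 1"
  \<comment> \<open>The shift by two matches sequence entries with indices \<open>j \<ge> 2\<close>;
    the coefficient \<open>f 1\<close> of the limit is excluded.\<close>
  define L where "L n \<longleftrightarrow> \<bar>f (Suc (Suc n))\<bar> \<ge> 1/2" for n
  have ge2: "j \<ge> 2 \<longleftrightarrow> (\<exists>n. j = Suc (Suc n))" for j :: nat
    using le_Suc_ex[of 2 j] by auto
  have exL: "(\<exists>j\<ge>2. \<bar>f j\<bar> \<ge> 1/2) \<longleftrightarrow> (\<exists>n. L n)"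
    unfolding ge2 L_def by blast
  have ex1L: "(\<exists>!j. j \<ge> 2 \<and> \<bar>f j\<bar> \<ge> 1/2) \<longleftrightarrow> (\<exists>!n. L n)"
    unfolding ge2 L_def Ex1_def by blast
  have nz: "f (Suc (Suc n)) \<noteq> 0" if "L n" for n
    using that by (auto simp: L_def)
  have Q: "?Q (kill_coord f n)" if "L n" for n
    using projection_onto_kill_coord[OF assms(1) nz[OF that]]
      onorm_kill_coord[OF assms(1) _ nz[OF that]] that assms(2) by (simp add: L_def)
  \<comment> \<open>A nonzero value exists in either case: a large \<open>f 2\<close> is the value
    at a unit vector, and a small one allows the sign construction.\<close>
  obtain w where w: "l1_action f w \<noteq> 0"
  proof (cases "L 0")
    case True
    then show thesis
      using that[of "unit_cseq 0"] nz l1_action_unit_cseq[OF assms(1)] by simp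
  next
    case False
    then show thesis
      using that exists_positive_with_prescribed_sign[OF assms(1), of 0 1] assms(2)
      by (force simp: L_def)
  qed
  have form: "\<exists>z. l1_action f z = 1 \<and> (\<forall>x. P x = x - l1_action f x *\<^sub>R z) \<and>
      (\<forall>n. \<not> L n \<longrightarrow> Rep_cseq z n = 0)" if P: "?Q P" for P
  proof -
    obtain z where z: "l1_action f z = 1" "\<And>x. P x = x - l1_action f x *\<^sub>R z"
      using projection_onto_W_form[OF assms(1) _ w] P by blast
    have "Rep_cseq z n = 0" if "\<not> L n" for n
      by (rule projection_vector_vanishes[OF assms(1) _ _ z(2)])
        (use P that assms(2) in \<open>auto simp: L_def projection_onto_def\<close>)
    then show ?thesis
      using z by blast
  qed
  have zero: "l1_action f 0 = 0"
    using l1_action_scaleR[OF assms(1), of 0 0] by simp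
  have ex: "\<exists>n. L n" if P: "?Q P" for P
  proof (rule ccontr)
    assume "\<nexists>n. L n"
    then obtain z where "l1_action f z = 1" "\<And>n. Rep_cseq z n = 0"
      using form[OF P] by blast
    then show False
      using zero cseq_eqI[of z 0] by (simp add: zero_cseq.rep_eq)
  qed
  \<comment> \<open>With at most one large coefficient, \<open>z\<close> is a multiple of
    \<open>unit_cseq n\<close>, and action 1 fixes the factor.\<close>
  have unique: "P = kill_coord f n" if P: "?Q P" and n: "\<And>m. L m \<Longrightarrow> m = n" for P n
  proof
    fix x
    obtain z where z: "l1_action f z = 1" "\<And>x. P x = x - l1_action f x *\<^sub>R z"
      and supp: "\<And>m. \<not> L m \<Longrightarrow> Rep_cseq z m = 0"
      using form[OF P] by blast
    have z_eq: "z = Rep_cseq z n *\<^sub>R unit_cseq n"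
      by (rule cseq_eqI) (use n supp in \<open>auto simp: scaleR_cseq.rep_eq\<close>)
    have "Rep_cseq z n * f (Suc (Suc n)) = 1"
      using z(1) by (subst (asm) z_eq)
        (simp add: l1_action_scaleR[OF assms(1)] l1_action_unit_cseq[OF assms(1)])
    then have "Rep_cseq z n = 1 / f (Suc (Suc n))"
      by (metis mult_zero_right nonzero_eq_divide_eq zero_neq_one)
    with z_eq have "z = (1 / f (Suc (Suc n))) *\<^sub>R unit_cseq n"
      by metis
    then show "P x = kill_coord f n x"
      by (simp add: z(2) kill_coord_def)
  qed
  have "(\<exists>!P. ?Q P) \<longleftrightarrow> (\<exists>!n. L n)"
  proof
    assume ex1: "\<exists>!P. ?Q P"
    then obtain n where n: "L n"
      using ex by blast
    \<comment> \<open>Two large coefficients would yield two different norm-1 projections.\<close>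
    moreover have "m = n" if "L m" for m
      using ex1 Q[OF n] Q[OF that] kill_coord_eq_imp_eq[OF assms(1) nz[OF that]] by blast
    ultimately show "\<exists>!n. L n"
      by blast
  next
    assume "\<exists>!n. L n"
    then obtain n where n: "L n" "\<And>m. L m \<Longrightarrow> m = n"
      by blast
    then show "\<exists>!P. ?Q P"
      using Q[OF n(1)] unique[OF _ n(2)] by (intro ex1I) blast+
  qed
  moreover have "(\<exists>P. ?Q P) \<longleftrightarrow> (\<exists>n. L n)"
    using ex Q by blast
  ultimately show ?thesis
    unfolding exL ex1L by blast
qed

end
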